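(* Let $d,r,m,k$ be integers such that $d\ge 0$, $r\ge d+1$, $1\le m\le r$, and $m\le k\le\min\{m+d,r\}$. Let $\mathcal C=\mathcal C_1\sqcup\cdots\sqcup\mathcal C_r$ be a finite family of convex sets in $\mathbb R^d$, colored with $r$ different colors (the color classes $\mathcal C_1,\dots,\mathcal C_r$ being nonempty). Assume: - if $|\mathcal C|\ge m+d$: every subfamily of $\mathcal C$ consisting of $m+d$ sets and colored with at least $k$ colors is $d$-semi-intersecting; - if $r\le|\mathcal C|<m+d$: the family $\mathcal C$ itself is $d$-semi-intersecting. Set $s=r-k+1$ and let $p=1$ if $k=1$ and $p=d+1$ if $k\ge 2$. Then there are pairwise distinct sets $I_1,\dots,I_p\in\binom{[r]}{s}$ such that $$\sum_{j=1}^{p}\dim K_{I_j}(\mathcal C)\ \ge\ 0 .$$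
   Context: Families are indexed: members of different color classes are regarded as different members of $\mathcal C$ even if they coincide as sets. A subfamily is colored with at least $k$ colors if it meets at least $k$ of the classes $\mathcal C_1,\dots,\mathcal C_r$. A finite family $\mathcal G$ of sets of size at least $d+1$ (i.e. $|\mathcal G|\ge d+1$) is *$d$-semi-intersecting* if for every proper subfamily $\mathcal A\subsetneq\mathcal G$ with $|\mathcal A|=d$ there is a set $C\in\mathcal G\setminus\mathcal A$ such that $\bigcap(\mathcal A\cup\{C\})\ne\varnothing$. $[r]=\{1,\dots,r\}$, and $\binom{[r]}{s}$ is the set of all $s$-element subsets of $[r]$. For $I\subseteq[r]$, $K_I(\mathcal C)=\bigcap_{i\in I}\bigl(\bigcap\mathcal C_i\bigr)$. The dimension of a nonempty convex set is the dimension of its affine hull, and $\dim\varnothing=-1$. *)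

theory Defs
  imports "HOL-Analysis.Analysis"
begin

(* A family of sets is a function C on a finite index set, and a subfamily is a set of
   indices; so two members with different indices are different members even if they are
   equal as sets.  A colouring is a function col on the indices.

   R^d is rendered as a d-dimensional linear subspace of an arbitrary Euclidean space,
   because a type of class euclidean_space has dimension at least 1 and d = 0 is allowed.
   Taking the subspace to be UNIV gives R^d itself for d >= 1. *)

definition semi_intersecting :: "nat \<Rightarrow> ('i \<Rightarrow> 'a set) \<Rightarrow> 'i set \<Rightarrow> bool" where
  "semi_intersecting d C G \<longleftrightarrow>
     finite G \<and> d + 1 \<le> card G \<and>
     (\<forall>A. A \<subset> G \<and> card A = d \<longrightarrow> (\<exists>c \<in> G - A. (\<Inter>j \<in> A \<union> {c}. C j) \<noteq> {}))"

definition color_class :: "'i set \<Rightarrow> ('i \<Rightarrow> nat) \<Rightarrow> nat \<Rightarrow> 'i set" where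
  "color_class J col i = {j \<in> J. col j = i}"

(* An intersection over no sets is UNIV here, but below I and all colour classes are
   nonempty. *)
definition K_set :: "'i set \<Rightarrow> ('i \<Rightarrow> nat) \<Rightarrow> ('i \<Rightarrow> 'a set) \<Rightarrow> nat set \<Rightarrow> 'a set" where
  "K_set J col C I = (\<Inter>i \<in> I. \<Inter>j \<in> color_class J col i. C j)"

end

theory Submission imports Defs begin

text \<open>
  Replacing each set by the convex hull of points chosen from the nonempty intersections, one may
  assume that the sets are polytopes.  Call a subfamily of $d$ sets admissible if it has at least
  $k-m$ colors; every admissible subfamily intersects.  Given a point $z$, choose an admissible $A$ maximising the distance from $z$ to
  $\bigcap A$, attained at $x$.  By Helly's theorem the point of the intersection of $d+1$ convex
  sets closest to $z$ is already closest to $z$ for $d$ of them, so by maximality $x$ lies in every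
  further set that meets $\bigcap A$ and whose addition to $A$ leaves all $d$-subsets admissible.
  Semi-intersection then leaves fewer than $k$ colors containing a set that misses $x$, and
  $x \in K_I$ for some $I$.

  If all sums of $d+1$ dimensions were negative, the union of the $K_I$ would lie in a hyperplane $H$.
  Moving $z$ far away on either side of $H$ shows that every admissible subfamily meets
  $H$.  Hence, after deleting a color $c$ from some $I_0$ with $K_{I_0} \neq \emptyset$, the
  traces on $H$ satisfy the hypotheses in dimension $d-1$ with $m=1$; together with $I_0$, the sets
  that induction provides yield a contradiction.
\<close>

section \<open>Counting, affine dimension and separation\<close>

lemma le_choose:
  assumes "1 \<le> s" "s < r"
  shows "r \<le> r choose s"
  using assms
proof (induction r arbitrary: s)
  case (Suc r)
  obtain t where t: "s = Suc t" using Suc.prems by (cases s) auto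
  show ?case
  proof (cases "s = r")
    case True
    then show ?thesis by simp
  next
    case False
    then have "r \<le> r choose s" using Suc by simp
    moreover have "1 \<le> r choose t"
      using Suc.prems t by (simp add: Suc_le_eq)
    ultimately show ?thesis using t by simp
  qed
qed simp

text \<open>Adding 1 to a dimension gives the size of an affine basis, and the union of bases spans
  the union of the sets. An empty set contributes 0, which later allows padding with empty
  sets.\<close>

lemma aff_dim_UN_le:
  fixes K :: "'b \<Rightarrow> 'a::euclidean_space set"
  assumes "finite F"
  shows "aff_dim (\<Union>i\<in>F. K i) + 1 \<le> (\<Sum>i\<in>F. aff_dim (K i) + 1)"
proof -
  have "\<forall>i. \<exists>B. \<not> affine_dependent B \<and> affine hull K i = affine hull B"
    using affine_basis_exists by metis
  then obtain B where B: "\<And>i. \<not> affine_dependent (B i)" "\<And>i. affine hull K i = affine hull B i"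
    by metis
  have card: "int (card (B i)) = aff_dim (K i) + 1" for i
    using aff_dim_unique[of "B i" "K i"] B by auto
  have fin: "finite (\<Union>i\<in>F. B i)"
    using assms B aff_independent_finite by blast
  have "K i \<subseteq> affine hull (\<Union>i\<in>F. B i)" if "i \<in> F" for i
    by (metis B(2) UN_upper hull_mono hull_subset subset_trans that)
  then have "aff_dim (\<Union>i\<in>F. K i) \<le> aff_dim (\<Union>i\<in>F. B i)"
    by (metis UN_least aff_dim_affine_hull aff_dim_subset)
  also have "\<dots> \<le> int (card (\<Union>i\<in>F. B i)) - 1"
    using aff_dim_le_card[OF fin] by simp
  also have "\<dots> \<le> int (\<Sum>i\<in>F. card (B i)) - 1"
    using card_UN_le[OF assms, of B] by linarith
  finally show ?thesis by (simp add: card)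
qed

lemma hyperplane_through_separating_point:
  fixes U :: "'a::euclidean_space set"
  assumes "U \<noteq> {}" "v \<notin> affine hull U"
  obtains u b where "U \<subseteq> {x. u \<bullet> x = b}" "u \<bullet> v \<noteq> b"
proof -
  define w where "w = closest_point (affine hull U) v"
  have w: "w \<in> affine hull U"
    unfolding w_def using assms by (intro closest_point_in_set) auto
  have le: "(v - w) \<bullet> (y - w) \<le> 0" if "y \<in> affine hull U" for y
    unfolding w_def using that by (intro closest_point_dot) (auto intro: affine_imp_convex)
  have "(v - w) \<bullet> y = (v - w) \<bullet> w" if "y \<in> U" for y
  proof -
    have y: "y \<in> affine hull U" using that hull_subset by fast
    \<comment> \<open>The reflection of \<open>y\<close> in \<open>w\<close> stays in the hull, so
      the nearest-point inequality holds in both directions and becomes an equality.\<close>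
    have "2 *\<^sub>R w + (-1) *\<^sub>R y \<in> affine hull U"
      using mem_affine[OF affine_affine_hull w y, of 2 "-1"] by simp
    then have "(v - w) \<bullet> (2 *\<^sub>R w + (-1) *\<^sub>R y - w) \<le> 0" by (rule le)
    moreover have "2 *\<^sub>R w + (-1) *\<^sub>R y - w = - (y - w)" by (simp add: scaleR_2)
    ultimately show ?thesis using le[OF y] by (simp add: inner_diff_right)
  qed
  moreover have "(v - w) \<bullet> v \<noteq> (v - w) \<bullet> w"
    using assms w by (metis eq_iff_diff_eq_0 inner_diff_right inner_eq_zero_iff)
  ultimately show ?thesis by (intro that[of "v - w" "(v - w) \<bullet> w"]) auto
qed

section \<open>Helly's theorem in a flat and nearest points\<close>

text \<open>Radon's argument: pick \<open>x i\<close> in all sets except possibly \<open>D i\<close>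
  and split these points into two parts with meeting hulls. For each \<open>j\<close> one part omits
  \<open>x j\<close>, so its hull lies in \<open>D j\<close>.\<close>

lemma Helly_affine_one_more:
  fixes D :: "'b \<Rightarrow> 'a::euclidean_space set"
  assumes "affine V" "aff_dim V = int d" "card T = d + 2"
    and D: "\<And>i. i \<in> T \<Longrightarrow> convex (D i) \<and> D i \<subseteq> V"
    and ne: "\<And>i. i \<in> T \<Longrightarrow> (\<Inter>j\<in>T - {i}. D j) \<noteq> {}"
  shows "(\<Inter>i\<in>T. D i) \<noteq> {}"
proof -
  define x where "x i = (SOME y. y \<in> (\<Inter>j\<in>T - {i}. D j))" for i
  have "x i \<in> (\<Inter>j\<in>T - {i}. D j)" if "i \<in> T" for i
    unfolding x_def using ne[OF that] by (rule some_in_eq[THEN iffD2])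
  then have x: "\<And>i j. i \<in> T \<Longrightarrow> j \<in> T \<Longrightarrow> j \<noteq> i \<Longrightarrow> x i \<in> D j"
    by blast
  have finT: "finite T" using assms(3) by (simp add: card_ge_0_finite)
  show ?thesis
  proof (cases "inj_on x T")
    case False
    then obtain i j where "i \<in> T" "j \<in> T" "i \<noteq> j" "x i = x j"
      by (auto simp: inj_on_def)
    then have "\<forall>l\<in>T. x i \<in> D l" using x by metis
    then show ?thesis by blast
  next
    case True
    have "x ` T \<subseteq> V"
    proof (rule image_subsetI)
      fix i assume i: "i \<in> T"
      have "card (T - {i}) \<noteq> 0" using assms(3) i finT by simp
      then obtain j where "j \<in> T" "j \<noteq> i"
        by (metis DiffD1 DiffD2 all_not_in_conv card.empty singletonI)
      then show "x i \<in> V" using x[OF i] D by blast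
    qed
    then have "aff_dim (x ` T) \<le> int d" using aff_dim_subset assms(2) by metis
    moreover have "card (x ` T) = d + 2" using True assms(3) by (simp add: card_image)
    ultimately have "affine_dependent (x ` T)"
      using aff_dim_affine_independent[of "x ` T"] by force
    then obtain M P where MP: "M \<subseteq> x ` T" "P \<subseteq> x ` T" "M \<inter> P = {}"
        "convex hull M \<inter> convex hull P \<noteq> {}"
      by (rule Radon)
    have *: "convex hull N \<subseteq> D j" if "N \<subseteq> x ` T" "x j \<notin> N" "j \<in> T" for N j
      using that x D by (intro hull_minimal) (blast, simp)
    obtain y where "y \<in> convex hull M" "y \<in> convex hull P" using MP(4) by blast
    then have "y \<in> D j" if "j \<in> T" for j
      using *[OF MP(1) _ that] *[OF MP(2) _ that] MP(3) by blast
    then show ?thesis by blast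
  qed
qed

text \<open>The \<open>d + 1\<close> sets and the open ball around \<open>z\<close> reaching to the
  nearest point have no common point. Helly's theorem then gives \<open>d + 1\<close> of these
  \<open>d + 2\<close> sets that already have none.\<close>

lemma closest_point_Inter_determined:
  fixes C :: "'i \<Rightarrow> 'a::euclidean_space set"
  assumes V: "affine V" "aff_dim V = int d" and G: "card G = d + 1"
    and C: "\<And>j. j \<in> G \<Longrightarrow> convex (C j) \<and> closed (C j) \<and> C j \<subseteq> V"
    and ne: "(\<Inter>j\<in>G. C j) \<noteq> {}"
  obtains j where "j \<in> G"
    "\<And>w. w \<in> V \<inter> (\<Inter>i\<in>G - {j}. C i) \<Longrightarrow> dist z (closest_point (\<Inter>j\<in>G. C j) z) \<le> dist z w"
proof -
  define \<rho> where "\<rho> = dist z (closest_point (\<Inter>j\<in>G. C j) z)"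
  define D where "D = case_option (ball z \<rho> \<inter> V) C"
  define T where "T = insert None (Some ` G)"
  have finG: "finite G" using G by (simp add: card_ge_0_finite)
  have cT: "card T = d + 2"
    unfolding T_def using finG G by (simp add: card_image)
  have clo: "closed (\<Inter>j\<in>G. C j)" using C by blast
  have "(\<Inter>i\<in>T. D i) = {}"
  proof (rule equals0I)
    fix y assume "y \<in> (\<Inter>i\<in>T. D i)"
    then have "y \<in> ball z \<rho>" "y \<in> (\<Inter>j\<in>G. C j)" by (auto simp: T_def D_def)
    then show False using closest_point_le[OF clo, of y z] by (simp add: \<rho>_def)
  qed
  moreover have "convex (D i) \<and> D i \<subseteq> V" if "i \<in> T" for i
  proof (cases i)
    case None
    then show ?thesis using V(1) by (simp add: D_def affine_imp_convex convex_Int)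
  next
    case (Some j)
    then show ?thesis using that C by (auto simp: T_def D_def)
  qed
  ultimately obtain i where i: "i \<in> T" "(\<Inter>j\<in>T - {i}. D j) = {}"
    using Helly_affine_one_more[OF V cT, of D] by metis
  have "T - {None} = Some ` G" by (auto simp: T_def)
  \<comment> \<open>The ball cannot be the set left out, since the sets \<open>C j\<close> alone do
    intersect; so a set \<open>C j\<close> is left out.\<close>
  then have "i \<noteq> None"
    using i(2) ne by (metis (no_types, lifting) D_def INF_cong image_image option.case(2))
  then obtain j where j: "i = Some j" "j \<in> G" using i(1) by (auto simp: T_def)
  have "T - {i} = insert None (Some ` (G - {j}))" using j by (auto simp: T_def)
  then have "ball z \<rho> \<inter> V \<inter> (\<Inter>i\<in>G - {j}. C i) = {}" using i(2) by (simp add: D_def)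
  then have "\<rho> \<le> dist z w" if "w \<in> V \<inter> (\<Inter>i\<in>G - {j}. C i)" for w
    using that by (meson disjoint_iff IntI IntD1 IntD2 mem_ball not_le)
  then show ?thesis using that j(2) unfolding \<rho>_def by blast
qed

section \<open>Colored families and their admissible subfamilies\<close>

text \<open>Take one set for each of the \<open>n\<close> colors still missing, then fill up to
  \<open>m\<close> sets arbitrarily. If \<open>A\<close> has exactly \<open>k - m\<close> colors,
  then \<open>n = m\<close>, nothing is filled up, and every set of \<open>Y\<close> has a new
  color.\<close>

lemma extend_with_colors:
  assumes "finite A" "finite X" "m \<le> k" "m \<le> card X" "k \<le> card (col ` (A \<union> X))"
    and a: "k - m \<le> card (col ` A)"
  obtains Y where "Y \<subseteq> X" "card Y = m" "k \<le> card (col ` (A \<union> Y))"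
    "card (col ` A) = k - m \<Longrightarrow> col ` Y \<inter> col ` A = {}"
proof -
  define n where "n = k - card (col ` A)"
  have "col ` (A \<union> X) = col ` A \<union> (col ` X - col ` A)" by auto
  then have "card (col ` (A \<union> X)) = card (col ` A) + card (col ` X - col ` A)"
    using assms(1,2) card_Un_disjoint[of "col ` A" "col ` X - col ` A"] by simp
  then have "n \<le> card (col ` X - col ` A)" using assms(5) by (simp add: n_def)
  then obtain Q where Q: "Q \<subseteq> col ` X - col ` A" "card Q = n"
    by (meson obtain_subset_with_card_n)
  then have "Q \<subseteq> col ` X" by blast
  then obtain T where T: "T \<subseteq> X" "inj_on col T" "Q = col ` T"
    by (auto simp: subset_image_inj)
  have cT: "card T = n" using T Q(2) card_image by metis
  have "n \<le> m" using a assms(3) by (simp add: n_def)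
  then obtain Y where Y: "T \<subseteq> Y" "Y \<subseteq> X" "card Y = m"
    using exists_subset_between[of T m X] cT assms T by auto
  have finY: "finite Y" using Y assms(2) finite_subset by blast
  have "card (col ` A) + n = card (col ` A \<union> Q)"
    using Q assms(1) T finite_subset[OF T(1) assms(2)] by (subst card_Un_disjoint) auto
  also have "\<dots> \<le> card (col ` (A \<union> Y))"
    using T Y finY assms(1) by (intro card_mono) auto
  finally have "k \<le> card (col ` (A \<union> Y))" by (simp add: n_def)
  moreover have "col ` Y \<inter> col ` A = {}" if "card (col ` A) = k - m"
  proof -
    have "card T = card Y"
      using that cT Y(3) assms(3) by (simp add: n_def)
    then have "T = Y" using Y(1) finY by (simp add: card_subset_eq)
    then show ?thesis using Q T by blast
  qed
  ultimately show ?thesis using that Y by blast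
qed

lemma mem_K_set_iff: "x \<in> K_set J col C I \<longleftrightarrow> (\<forall>j\<in>J. col j \<in> I \<longrightarrow> x \<in> C j)"
  by (auto simp: K_set_def color_class_def)

lemma aff_dim_nonneg:
  fixes S :: "'a::euclidean_space set"
  shows "S \<noteq> {} \<Longrightarrow> 0 \<le> aff_dim S"
  by (metis aff_dim_negative_iff not_le)

text \<open>The color set is arbitrary and the ambient flat affine, so that colors can be deleted and
  hyperplane sections taken.\<close>

locale colored_family =
  fixes V :: "'a::euclidean_space set" and d :: nat and R :: "nat set" and J :: "'i set"
    and col :: "'i \<Rightarrow> nat" and C :: "'i \<Rightarrow> 'a set" and m k :: nat
  assumes affine_V: "affine V" and aff_dim_V: "aff_dim V = int d"
    and finite_R: "finite R" and d_less_R: "d + 1 \<le> card R"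
    and m_pos: "1 \<le> m" and m_le_k: "m \<le> k" and k_le_md: "k \<le> m + d" and k_le_R: "k \<le> card R"
    and finite_J: "finite J" and col_J: "col ` J = R"
    and C: "\<And>j. j \<in> J \<Longrightarrow> convex (C j) \<and> compact (C j) \<and> C j \<subseteq> V"
    and semi: "\<And>G. G \<subseteq> J \<Longrightarrow> card G = m + d \<Longrightarrow> k \<le> card (col ` G) \<Longrightarrow> semi_intersecting d C G"
    and semi_J: "card J < m + d \<Longrightarrow> semi_intersecting d C J"
begin

text \<open>The bound \<open>k - m\<close> is the least number of colors that \<open>m\<close>
  further sets can raise to \<open>k\<close>.\<close>

definition admissible :: "'i set \<Rightarrow> bool" where
  "admissible A \<longleftrightarrow> A \<subseteq> J \<and> card A = d \<and> k - m \<le> card (col ` A)"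

text \<open>Intersecting with \<open>V\<close> makes the core of the empty family the flat itself
  instead of the whole space.\<close>

definition core :: "'i set \<Rightarrow> 'a set" where
  "core A = V \<inter> (\<Inter>j\<in>A. C j)"

lemma core_ne:
  assumes "A \<subseteq> J" "(\<Inter>j\<in>A. C j) \<noteq> {}"
  shows "core A \<noteq> {}"
proof (cases "A = {}")
  case True
  then show ?thesis using aff_dim_V by (auto simp: core_def)
next
  case False
  then show ?thesis using assms C unfolding core_def by blast
qed

lemma card_J: "card R \<le> card J"
  using card_image_le[OF finite_J, of col] by (simp add: col_J)

text \<open>Adding \<open>m\<close> suitable sets of \<open>X\<close> to \<open>A\<close> gives
  \<open>m + d\<close> sets with at least \<open>k\<close> colors, to which semi-intersection
  applies. The clause on the color of \<open>c\<close> is what keeps families admissible when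
  \<open>c\<close> is exchanged for a member of \<open>A\<close>.\<close>

lemma intersecting_extension_by_one:
  assumes A: "admissible A" and X: "X \<subseteq> J - A" "m \<le> card X" "k \<le> card (col ` (A \<union> X))"
  obtains c where "c \<in> X" "(\<Inter>j\<in>insert c A. C j) \<noteq> {}"
    "card (col ` A) = k - m \<Longrightarrow> col c \<notin> col ` A"
proof -
  have AJ: "A \<subseteq> J" "card A = d" "k - m \<le> card (col ` A)" using A by (auto simp: admissible_def)
  have fin: "finite A" "finite X" using AJ X finite_J by (auto intro: finite_subset)
  obtain Y where Y: "Y \<subseteq> X" "card Y = m" "k \<le> card (col ` (A \<union> Y))"
      "card (col ` A) = k - m \<Longrightarrow> col ` Y \<inter> col ` A = {}"
    using extend_with_colors[OF fin m_le_k X(2,3) AJ(3)] by metis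
  have finY: "finite Y" using Y(1) fin finite_subset by blast
  have disj: "A \<inter> Y = {}" using X Y by blast
  have "card (A \<union> Y) = m + d" using disj fin finY Y AJ by (simp add: card_Un_disjoint)
  then have "semi_intersecting d C (A \<union> Y)"
    using semi[of "A \<union> Y"] X Y AJ by blast
  moreover have "Y \<noteq> {}" using Y(2) m_pos by auto
  then have "A \<subset> A \<union> Y" using disj by blast
  ultimately obtain c where c: "c \<in> (A \<union> Y) - A" "(\<Inter>j\<in>A \<union> {c}. C j) \<noteq> {}"
    using AJ unfolding semi_intersecting_def by blast
  show ?thesis
  proof (rule that)
    show "c \<in> X" using c Y by blast
    show "(\<Inter>j\<in>insert c A. C j) \<noteq> {}" using c(2) by simp
    show "col c \<notin> col ` A" if "card (col ` A) = k - m" using Y(4)[OF that] c by blast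
  qed
qed

lemma core_admissible_ne:
  assumes A: "admissible A"
  shows "core A \<noteq> {}"
proof -
  have AJ: "A \<subseteq> J" "card A = d" using A by (auto simp: admissible_def)
  obtain c where c: "(\<Inter>j\<in>insert c A. C j) \<noteq> {}"
  \<comment> \<open>A family with fewer than \<open>m + d\<close> members has no subfamily to which
    \<open>semi\<close> applies; there \<open>semi_J\<close> is used.\<close>
  proof (cases "card J < m + d")
    case True
    have "A \<noteq> J" using AJ card_J d_less_R by auto
    then have "A \<subset> J" using AJ by blast
    then obtain c where "(\<Inter>j\<in>A \<union> {c}. C j) \<noteq> {}"
      using semi_J[OF True] AJ unfolding semi_intersecting_def by blast
    then show ?thesis using that[of c] by simp
  next
    case False
    then have "m \<le> card (J - A)"
      using AJ finite_J finite_subset by (subst card_Diff_subset) auto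
    moreover have "k \<le> card (col ` (A \<union> (J - A)))"
      using AJ k_le_R col_J by (simp add: Un_absorb1)
    ultimately show ?thesis
      using intersecting_extension_by_one[OF A subset_refl] that by metis
  qed
  have "(\<Inter>j\<in>insert c A. C j) \<subseteq> (\<Inter>j\<in>A. C j)" by blast
  then show ?thesis using core_ne[OF AJ(1)] c by (metis subset_empty)
qed

text \<open>Any \<open>d\<close> sets of distinct colors will do, because
  \<open>k <= m + d\<close>.\<close>

lemma admissible_ex: "\<exists>A. admissible A"
proof -
  obtain Q where Q: "Q \<subseteq> R" "card Q = d" 
    using d_less_R by (meson add_leD1 obtain_subset_with_card_n)
  then have "Q \<subseteq> col ` J" using col_J by blast
  then obtain A where A: "A \<subseteq> J" "inj_on col A" "Q = col ` A" by (auto simp: subset_image_inj)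
  then have "card A = d" using Q card_image by metis
  then show ?thesis using A Q k_le_md by (auto simp: admissible_def)
qed

section \<open>The extremal point\<close>

text \<open>The last conclusion records the maximality of \<open>x\<close>: every admissible core
  comes at least as close to \<open>z\<close> as \<open>x\<close> does. It is exploited later for
  \<open>z\<close> far away.\<close>

lemma extremal_point:
  obtains x I where "I \<subseteq> R" "card I = card R - k + 1" "x \<in> K_set J col C I"
    "x \<in> V"
    "\<And>A. admissible A \<Longrightarrow> \<exists>y\<in>core A. dist z y \<le> dist z x"
proof -
  define f where "f A = dist z (closest_point (core A) z)" for A
  have closed_core: "closed (core A)" if "A \<subseteq> J" for A
    using that C affine_closed[OF affine_V] compact_imp_closed unfolding core_def by blast
  have convex_core: "convex (core A)" if "A \<subseteq> J" for A
    using that C affine_imp_convex[OF affine_V] unfolding core_def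
    by (intro convex_Int convex_INT) auto
  have "finite {A. admissible A}"
    by (rule finite_subset[of _ "Pow J"]) (auto simp: admissible_def finite_J)
  then have fin: "finite (f ` {A. admissible A})" by simp
  then have "Max (f ` {A. admissible A}) \<in> f ` {A. admissible A}"
    using admissible_ex by (intro Max_in) auto
  then obtain A where A: "admissible A" and "f A = Max (f ` {A. admissible A})" by auto
  then have max: "f B \<le> f A" if "admissible B" for B
    using fin that by simp
  have AJ: "A \<subseteq> J" "card A = d" "k - m \<le> card (col ` A)" using A by (auto simp: admissible_def)
  have finA: "finite A" using AJ finite_J finite_subset by blast
  define x where "x = closest_point (core A) z"
  have x: "x \<in> core A"
    unfolding x_def by (intro closest_point_in_set closed_core AJ core_admissible_ne A)
  have good: "x \<in> C c"
    if c: "c \<in> J - A" "(\<Inter>j\<in>insert c A. C j) \<noteq> {}" "card (col ` A) = k - m \<Longrightarrow> col c \<notin> col ` A" for c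
  proof (rule ccontr)
    assume nx: "x \<notin> C c"
    let ?G = "insert c A"
    \<comment> \<open>Since \<open>x\<close> is the unique nearest point of \<open>core A\<close>
      and misses \<open>C c\<close>, \<open>y\<close> is farther from \<open>z\<close> than
      \<open>x\<close>. Dropping the right \<open>j\<close> leaves an admissible family whose core
      is no closer than \<open>y\<close>, against maximality.\<close>
    define y where "y = closest_point (\<Inter>j\<in>?G. C j) z"
    have G: "?G \<subseteq> J" "card ?G = d + 1" using c AJ finA by auto
    have "closed (\<Inter>j\<in>?G. C j)" using C G compact_imp_closed by blast
    then have y: "y \<in> (\<Inter>j\<in>?G. C j)" unfolding y_def using c(2) by (rule closest_point_in_set)
    then have "y \<in> core A" using C c(1) by (auto simp: core_def)
    then have lt: "f A < dist z y"
      unfolding f_def using closest_point_lt[OF convex_core[OF AJ(1)] closed_core[OF AJ(1)]] y nx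
      by (metis INT_D insertI1 x_def)
    obtain j where j: "j \<in> ?G" "\<And>w. w \<in> V \<inter> (\<Inter>i\<in>?G - {j}. C i) \<Longrightarrow> dist z y \<le> dist z w"
      using closest_point_Inter_determined[OF affine_V aff_dim_V G(2), of C z] c(2) C G(1)
        compact_imp_closed unfolding y_def by (metis subsetD)
    let ?B = "?G - {j}"
    have cc: "card (col ` A) \<le> card (col ` (A - {i})) + 1" for i
    proof -
      have "col ` A \<subseteq> insert (col i) (col ` (A - {i}))" by auto
      then have "card (col ` A) \<le> card (insert (col i) (col ` (A - {i})))"
        using finA by (intro card_mono) auto
      also have "\<dots> \<le> card (col ` (A - {i})) + 1" using card_insert_le_m1 finA by (simp add: card_insert_if)
      finally show ?thesis .
    qed
    txt \<open>Only if \<open>A\<close> has exactly \<open>k - m\<close> colors may removing \<open>j\<close> cost a color too many; then the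
      color of \<open>c\<close> is new and compensates for it.\<close>
    have "k - m \<le> card (col ` ?B)"
    proof (cases "j = c")
      case True
      then show ?thesis using AJ c(1) by simp
    next
      case False
      then have B: "col ` ?B = insert (col c) (col ` (A - {j}))" by auto
      show ?thesis
      proof (cases "card (col ` A) = k - m")
        case True
        then have "col c \<notin> col ` (A - {j})" using c(3) by blast
        then have "card (col ` ?B) = card (col ` (A - {j})) + 1" using B finA by simp
        then show ?thesis using cc[of j] True by simp
      next
        case False
        have "card (col ` (A - {j})) \<le> card (col ` ?B)"
          using B finA by (intro card_mono) auto
        then show ?thesis using cc[of j] False AJ(3) by linarith
      qed
    qed
    then have "admissible ?B" using G j(1) finA by (auto simp: admissible_def)
    moreover then have "closest_point (core ?B) z \<in> core ?B"
      using closed_core[of ?B] core_admissible_ne[of ?B] G(1) by (intro closest_point_in_set) auto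
    then have "dist z y \<le> f ?B" using j(2) by (simp add: core_def f_def)
    ultimately show False using max[of ?B] lt by linarith
  qed
  define B where "B = {j \<in> J. x \<notin> C j}"
  have BJ: "B \<subseteq> J - A" using x by (auto simp: B_def core_def)
  have finB: "finite B" using BJ finite_J finite_subset by blast
  have cB: "card (col ` B) \<le> card B" using finB by (rule card_image_le)
  \<comment> \<open>Otherwise \<open>B\<close> has enough sets and colors to extend \<open>A\<close>
    by some \<open>c\<close> in \<open>B\<close>, and \<open>good\<close> puts \<open>x\<close> into
    \<open>C c\<close>.\<close>
  have "card (col ` B) < k"
  proof (rule ccontr)
    assume "\<not> card (col ` B) < k"
    then have kB: "k \<le> card (col ` B)" by simp
    also have "\<dots> \<le> card (col ` (A \<union> B))" using finA finB by (intro card_mono) auto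
    finally have "k \<le> card (col ` (A \<union> B))" .
    moreover have "m \<le> card B" using kB cB m_le_k by linarith
    ultimately obtain c where "c \<in> B" "(\<Inter>j\<in>insert c A. C j) \<noteq> {}"
        "card (col ` A) = k - m \<Longrightarrow> col c \<notin> col ` A"
      using intersecting_extension_by_one[OF A BJ] by metis
    then show False using good[of c] BJ by (auto simp: B_def)
  qed
  moreover have "card R - card (col ` B) \<le> card (R - col ` B)"
    using finB by (intro diff_card_le_card_Diff) auto
  ultimately have "card R - k + 1 \<le> card (R - col ` B)" using k_le_R by linarith
  then obtain I where I: "I \<subseteq> R - col ` B" "card I = card R - k + 1"
    by (meson obtain_subset_with_card_n)
  have "x \<in> K_set J col C I"
    using I by (auto simp: K_set_def color_class_def B_def)
  moreover have "I \<subseteq> R" using I(1) by blast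
  moreover have "x \<in> V" using x by (simp add: core_def)
  moreover have "\<exists>y\<in>core B. dist z y \<le> dist z x" if "admissible B" for B
    using max[OF that] closest_point_in_set[OF closed_core core_admissible_ne[OF that]] that
    unfolding f_def x_def admissible_def by blast
  ultimately show ?thesis using that[of I x] I(2) by blast
qed

section \<open>Admissible subfamilies and a hyperplane containing all \<open>K I\<close>\<close>

definition color_sets :: "nat set set" where
  "color_sets = {I. I \<subseteq> R \<and> card I = card R - k + 1}"

abbreviation K :: "nat set \<Rightarrow> 'a set" where
  "K \<equiv> K_set J col C"

lemma finite_color_sets: "finite color_sets"
  by (rule finite_subset[of _ "Pow R"]) (auto simp: color_sets_def finite_R)

lemma color_sets_ne: "I \<in> color_sets \<Longrightarrow> I \<noteq> {}"
  by (auto simp: color_sets_def)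

lemma K_ne_ex: "\<exists>I\<in>color_sets. K I \<noteq> {}"
  by (rule extremal_point) (auto simp: color_sets_def)

lemma K_subset_member:
  assumes "I \<in> color_sets"
  obtains j where "j \<in> J" "K I \<subseteq> C j"
proof -
  obtain i where "i \<in> I" "i \<in> R"
    using assms color_sets_ne by (auto simp: color_sets_def)
  then obtain j where "j \<in> J" "col j = i" using col_J by auto
  then show ?thesis using that[of j] \<open>i \<in> I\<close> by (simp add: mem_K_set_iff subset_iff)
qed

text \<open>Seen from a very distant point \<open>- N *\<^sub>R u\<close>, comparing distances of
  points in a bounded region amounts to comparing their values of \<open>u\<close>, up to a bounded
  error. A core strictly beyond the hyperplane would then be farther away than the extremal point,
  which lies on it.\<close>

lemma core_reaches_halfspace:
  assumes "1 \<le> d" and H: "\<And>I. I \<in> color_sets \<Longrightarrow> K I \<subseteq> {x. u \<bullet> x = b}" and A: "admissible A"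
  shows "\<exists>y\<in>core A. u \<bullet> y \<le> b"
proof (rule ccontr)
  assume "\<not> ?thesis"
  then have gt: "b < u \<bullet> y" if "y \<in> core A" for y using that by force
  have AJ: "A \<subseteq> J" "card A = d" using A by (auto simp: admissible_def)
  \<comment> \<open>A member exists because \<open>1 <= d\<close>; its compactness passes to the
    core.\<close>
  then obtain a where a: "a \<in> A" using assms(1) by fastforce
  have "core A = C a \<inter> core A" using a by (auto simp: core_def)
  moreover have "closed (core A)"
    using AJ C affine_closed[OF affine_V] compact_imp_closed unfolding core_def by blast
  moreover have "compact (C a)" using AJ a C by blast
  ultimately have "compact (core A)" by (metis compact_Int_closed)
  moreover have "continuous_on (core A) (\<lambda>y. u \<bullet> y)" by (intro continuous_intros)
  ultimately obtain y0 where y0: "y0 \<in> core A" "\<And>y. y \<in> core A \<Longrightarrow> u \<bullet> y0 \<le> u \<bullet> y"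
    using continuous_attains_inf[OF _ core_admissible_ne[OF A]] by metis
  have "bounded (\<Union>j\<in>J. C j)"
    using C compact_imp_bounded finite_J by blast
  then obtain B where B: "\<And>j x. j \<in> J \<Longrightarrow> x \<in> C j \<Longrightarrow> norm x \<le> B"
    by (auto simp: bounded_iff)
  define \<delta> where "\<delta> = u \<bullet> y0 - b"
  have \<delta>: "0 < \<delta>" using gt[OF y0(1)] by (simp add: \<delta>_def)
  \<comment> \<open>The gap \<open>\<delta>\<close> in the value of \<open>u\<close> changes the
    squared distance by \<open>2 * N * \<delta>\<close>, chosen to exceed \<open>B\<^sup>2\<close>,
    the bound on the squared norm of \<open>x\<close>.\<close>
  define N where "N = (B\<^sup>2 + 1) / (2 * \<delta>)"
  have N: "0 \<le> N" "2 * N * \<delta> = B\<^sup>2 + 1" using \<delta> by (auto simp: N_def)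
  obtain x I where I: "I \<in> color_sets" "x \<in> K I"
    and far: "\<And>A. admissible A \<Longrightarrow> \<exists>y\<in>core A. dist (- N *\<^sub>R u) y \<le> dist (- N *\<^sub>R u) x"
    by (rule extremal_point[of "- N *\<^sub>R u"]) (auto simp: color_sets_def)
  obtain y where y: "y \<in> core A" "dist (- N *\<^sub>R u) y \<le> dist (- N *\<^sub>R u) x"
    using far[OF A] by blast
  have *: "(dist (- N *\<^sub>R u) v)\<^sup>2 = (norm (N *\<^sub>R u))\<^sup>2 + 2 * N * (u \<bullet> v) + (norm v)\<^sup>2" for v
    unfolding dist_norm power2_norm_eq_inner
    by (simp add: inner_diff_left inner_diff_right inner_commute algebra_simps)
  have "(dist (- N *\<^sub>R u) y)\<^sup>2 \<le> (dist (- N *\<^sub>R u) x)\<^sup>2" using y(2) by (simp add: power_mono)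
  then have "2 * N * (u \<bullet> y) + (norm y)\<^sup>2 \<le> 2 * N * b + (norm x)\<^sup>2"
    using H[OF I(1)] I(2) unfolding * by auto
  moreover have "2 * N * (b + \<delta>) \<le> 2 * N * (u \<bullet> y)"
    using N(1) y0(2)[OF y(1)] by (intro mult_left_mono) (auto simp: \<delta>_def)
  moreover have "(norm x)\<^sup>2 \<le> B\<^sup>2"
    using K_subset_member[OF I(1)] I(2) B by (metis norm_ge_zero power_mono subsetD)
  ultimately show False using N(2) by (simp add: distrib_left) (smt (verit) zero_le_power2)
qed

text \<open>Applying the half-space lemma to \<open>u\<close> and to \<open>- u\<close> gives points
  of the core on both sides; convexity joins them across the hyperplane.\<close>

lemma core_meets_hyperplane:
  assumes "1 \<le> d" and H: "\<And>I. I \<in> color_sets \<Longrightarrow> K I \<subseteq> {x. u \<bullet> x = b}" and A: "admissible A"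
  shows "core A \<inter> {x. u \<bullet> x = b} \<noteq> {}"
proof -
  obtain y where y: "y \<in> core A" "u \<bullet> y \<le> b"
    using core_reaches_halfspace[OF assms] by blast
  have "\<exists>y\<in>core A. (- u) \<bullet> y \<le> - b"
    using H by (intro core_reaches_halfspace assms(1) A) auto
  then obtain y' where y': "y' \<in> core A" "b \<le> u \<bullet> y'" by auto
  have "convex (core A)"
    using A C affine_imp_convex[OF affine_V] unfolding core_def admissible_def
    by (intro convex_Int convex_INT) auto
  then obtain w where "w \<in> core A" "u \<bullet> w = b"
    using connected_ivt_hyperplane[OF convex_connected y(1) y'(1) y(2) y'(2)] by blast
  then show ?thesis by blast
qed

lemma few_K_ne:
  assumes "\<And>F. F \<subseteq> color_sets \<Longrightarrow> card F = d + 1 \<Longrightarrow> (\<Sum>I\<in>F. aff_dim (K I)) < 0"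
  shows "card {I \<in> color_sets. K I \<noteq> {}} \<le> d"
proof (rule ccontr)
  assume "\<not> ?thesis"
  then have "d + 1 \<le> card {I \<in> color_sets. K I \<noteq> {}}" by simp
  then obtain F where F: "F \<subseteq> {I \<in> color_sets. K I \<noteq> {}}" "card F = d + 1"
    by (meson obtain_subset_with_card_n)
  then have "0 \<le> (\<Sum>I\<in>F. aff_dim (K I))" by (intro sum_nonneg aff_dim_nonneg) auto
  then show False using assms[of F] F by force
qed

text \<open>For \<open>2 <= k\<close> the index sets are nonempty and proper in \<open>R\<close>, so
  there are at least \<open>card R\<close> of them.\<close>

lemma d_less_card_color_sets:
  assumes "2 \<le> k"
  shows "d + 1 \<le> card color_sets"
proof -
  have "d + 1 \<le> card R choose (card R - k + 1)"
    using le_choose[of "card R - k + 1" "card R"] assms k_le_R d_less_R by linarith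
  then show ?thesis by (simp add: color_sets_def n_subsets[OF finite_R])
qed

lemma K_in_hyperplane:
  assumes "2 \<le> k"
    and neg: "\<And>F. F \<subseteq> color_sets \<Longrightarrow> card F = d + 1 \<Longrightarrow> (\<Sum>I\<in>F. aff_dim (K I)) < 0"
  obtains u b where "\<And>I. I \<in> color_sets \<Longrightarrow> K I \<subseteq> {x. u \<bullet> x = b}" "\<not> V \<subseteq> {x. u \<bullet> x = b}"
proof -
  let ?N = "{I \<in> color_sets. K I \<noteq> {}}"
  \<comment> \<open>All nonempty \<open>K I\<close> are collected in one family, padded with empty
    ones to exactly \<open>d + 1\<close> members. A negative sum of dimensions then forces the union
    to span less than \<open>V\<close>.\<close>
  obtain F where F: "?N \<subseteq> F" "F \<subseteq> color_sets" "card F = d + 1"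
    using exists_subset_between[of ?N "d + 1" color_sets] few_K_ne[OF neg]
      d_less_card_color_sets[OF assms(1)] finite_color_sets by auto
  have finF: "finite F" using F(2) finite_color_sets finite_subset by blast
  let ?U = "\<Union>I\<in>F. K I"
  have "aff_dim ?U + 1 \<le> (\<Sum>I\<in>F. aff_dim (K I) + 1)" by (rule aff_dim_UN_le[OF finF])
  also have "\<dots> = (\<Sum>I\<in>F. aff_dim (K I)) + int (d + 1)" using F(3) by (simp add: sum.distrib)
  finally have "aff_dim ?U < aff_dim V" using neg[OF F(2,3)] aff_dim_V by linarith
  then have "\<not> V \<subseteq> affine hull ?U" by (metis aff_dim_affine_hull aff_dim_subset not_le)
  then obtain v where v: "v \<in> V" "v \<notin> affine hull ?U" by blast
  have "?U \<noteq> {}" using K_ne_ex F(1) by blast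
  then obtain u b where ub: "?U \<subseteq> {x. u \<bullet> x = b}" "u \<bullet> v \<noteq> b"
    using hyperplane_through_separating_point[OF _ v(2)] by metis
  show ?thesis
  proof (rule that)
    show "K I \<subseteq> {x. u \<bullet> x = b}" if "I \<in> color_sets" for I
      using that F(1) ub(1) by (cases "K I = {}") auto
  qed (use ub(2) v(1) in auto)
qed

section \<open>Hyperplane sections and induction on the dimension\<close>

text \<open>With \<open>m = 1\<close> in dimension \<open>e\<close>, the relevant subfamilies have
  \<open>1 + e = d\<close> members and at least \<open>k - m\<close> colors, so they are admissible.
  All their members share a point of the hyperplane, which is stronger than
  semi-intersection.\<close>

lemma colored_family_hyperplane_section:
  assumes d: "d = Suc e" and H: "\<And>I. I \<in> color_sets \<Longrightarrow> K I \<subseteq> {x. u \<bullet> x = b}"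
    and V: "\<not> V \<subseteq> {x. u \<bullet> x = b}"
    and R': "R' \<subseteq> R" "d \<le> card R'" and k': "1 \<le> k'" "k' \<le> d" "k' \<le> card R'" "k - m \<le> k'"
  shows "colored_family (V \<inter> {x. u \<bullet> x = b}) e R' {j \<in> J. col j \<in> R'} col
           (\<lambda>j. C j \<inter> {x. u \<bullet> x = b}) 1 k'"
proof
  let ?H = "{x. u \<bullet> x = b}"
  show "affine (V \<inter> ?H)" by (intro affine_Int affine_V affine_hyperplane)
  obtain I where I: "I \<in> color_sets" "K I \<noteq> {}" using K_ne_ex by blast
  then obtain j where "j \<in> J" "K I \<subseteq> C j" using K_subset_member by metis
  then have "V \<inter> ?H \<noteq> {}" using I H C by blast
  then show "aff_dim (V \<inter> ?H) = int e"
    using V d aff_dim_V aff_dim_affine_Int_hyperplane[OF affine_V, of u b] by simp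
  show "finite R'" using R'(1) finite_R finite_subset by blast
  show "e + 1 \<le> card R'" "(1::nat) \<le> 1" "1 \<le> k'" "k' \<le> 1 + e" "k' \<le> card R'"
    using R'(2) k' d by auto
  show "finite {j \<in> J. col j \<in> R'}" using finite_J by simp
  show img: "col ` {j \<in> J. col j \<in> R'} = R'" using col_J R'(1) by auto
  show "convex (C j \<inter> ?H) \<and> compact (C j \<inter> ?H) \<and> C j \<inter> ?H \<subseteq> V \<inter> ?H"
    if "j \<in> {j \<in> J. col j \<in> R'}" for j
    using that C by (auto intro!: convex_Int compact_Int_closed convex_hyperplane closed_hyperplane)
  have "card R' \<le> card {j \<in> J. col j \<in> R'}"
    using card_image_le[of "{j \<in> J. col j \<in> R'}" col] img finite_J by simp
  then show "semi_intersecting e (\<lambda>j. C j \<inter> ?H) {j \<in> J. col j \<in> R'}"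
    if "card {j \<in> J. col j \<in> R'} < 1 + e"
    using that R'(2) d by simp
  show "semi_intersecting e (\<lambda>j. C j \<inter> ?H) G"
    if G: "G \<subseteq> {j \<in> J. col j \<in> R'}" "card G = 1 + e" "k' \<le> card (col ` G)" for G
  proof -
    have "admissible G" unfolding admissible_def using G k'(4) d by auto
    then have "core G \<inter> ?H \<noteq> {}" using core_meets_hyperplane[OF _ H] d by auto
    moreover have "core G \<inter> ?H \<subseteq> (\<Inter>j\<in>A \<union> {c}. C j \<inter> ?H)" if "A \<subseteq> G" "c \<in> G" for A c
      using that by (auto simp: core_def)
    ultimately have ne: "(\<Inter>j\<in>A \<union> {c}. C j \<inter> ?H) \<noteq> {}" if "A \<subseteq> G" "c \<in> G" for A c
      using that by (metis subset_empty)
    have "\<exists>c\<in>G - A. (\<Inter>j\<in>A \<union> {c}. C j \<inter> ?H) \<noteq> {}" if "A \<subset> G" for A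
      using that ne[of A] by blast
    moreover have "finite G" using G(2) by (simp add: card_ge_0_finite)
    ultimately show ?thesis using G(2) by (simp add: semi_intersecting_def)
  qed
qed

end

theorem colored_family_sum_aff_dim:
  assumes "colored_family V d R J col C m k"
  shows "\<exists>F \<subseteq> {I. I \<subseteq> R \<and> card I = card R - k + 1}.
           card F = (if k = 1 then 1 else d + 1) \<and> 0 \<le> (\<Sum>I\<in>F. aff_dim (K_set J col C I))"
  using assms
proof (induction d arbitrary: V R J C m k)
  case (0 V R J C m k)
  interpret colored_family V 0 R J col C m k by (rule 0)
  obtain I where "I \<in> color_sets" "K I \<noteq> {}" using K_ne_ex by blast
  \<comment> \<open>For \<open>d = 0\<close> both prescribed sizes of \<open>F\<close> are 1, so one
    nonempty \<open>K I\<close> suffices.\<close>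
  then show ?case
    by (intro exI[of _ "{I}"]) (auto simp: color_sets_def aff_dim_nonneg)
next
  case (Suc e V R J C m k)
  interpret colored_family V "Suc e" R J col C m k by (rule Suc.prems)
  obtain I0 where I0: "I0 \<in> color_sets" "K I0 \<noteq> {}" using K_ne_ex by blast
  then have I0R: "I0 \<subseteq> R" "card I0 = card R - k + 1" by (auto simp: color_sets_def)
  show ?case
  proof (cases "k = 1")
    case True
    then show ?thesis
      using I0(2) I0R by (intro exI[of _ "{I0}"]) (simp add: aff_dim_nonneg)
  next
    case False
    then have k: "2 \<le> k" using m_pos m_le_k by linarith
    show ?thesis
    proof (rule ccontr)
      assume neg: "\<not> ?thesis"
      have neg: "(\<Sum>I\<in>F. aff_dim (K I)) < 0" if "F \<subseteq> color_sets" "card F = Suc e + 1" for F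
      proof (rule ccontr)
        assume "\<not> ?thesis"
        then have "0 \<le> (\<Sum>I\<in>F. aff_dim (K I))" by simp
        then show False using neg that False unfolding color_sets_def by auto
      qed
      obtain u b where H: "\<And>I. I \<in> color_sets \<Longrightarrow> K I \<subseteq> {x. u \<bullet> x = b}"
        and V: "\<not> V \<subseteq> {x. u \<bullet> x = b}"
        using K_in_hyperplane[OF k neg] by metis
      txt \<open>On the section, \<open>card R - k + k'\<close> colors are kept, so that the index sets given by the
        induction hypothesis again have \<open>card R - k + 1\<close> elements.\<close>
      define k' where "k' = min (k - 1) (Suc e)"
      have k': "1 \<le> k'" "k' \<le> Suc e" "k' \<le> k - 1" "k - m \<le> k'"
        using k m_pos k_le_md by (auto simp: k'_def)
      have slice: "\<exists>F \<subseteq> color_sets. (\<forall>I\<in>F. c \<notin> I) \<and> card F = (if k' = 1 then 1 else Suc e) \<and>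
          0 \<le> (\<Sum>I\<in>F. aff_dim (K I))" if c: "c \<in> I0" for c
      proof -
        have "card R - k + k' \<le> card (R - {c})"
          using c I0R finite_R k k_le_R k'(3) by (simp add: subset_iff)
        then obtain R' where R': "R' \<subseteq> R - {c}" "card R' = card R - k + k'"
          by (meson obtain_subset_with_card_n)
        \<comment> \<open>If \<open>k' = k - 1\<close>, then \<open>card R'\<close> is
          \<open>card R - 1\<close>; otherwise \<open>k'\<close> alone is
          \<open>Suc e\<close>.\<close>
        have "Suc e \<le> card R'"
          using R'(2) d_less_R k_le_R k by (auto simp: k'_def min_def)
        then have "colored_family (V \<inter> {x. u \<bullet> x = b}) e R' {j \<in> J. col j \<in> R'} col
            (\<lambda>j. C j \<inter> {x. u \<bullet> x = b}) 1 k'"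
          using R' k' by (intro colored_family_hyperplane_section[OF _ H V]) auto
        from Suc.IH[OF this] obtain F
          where F: "F \<subseteq> {I. I \<subseteq> R' \<and> card I = card R' - k' + 1}"
            "card F = (if k' = 1 then 1 else e + 1)"
            "0 \<le> (\<Sum>I\<in>F. aff_dim (K_set {j \<in> J. col j \<in> R'} col (\<lambda>j. C j \<inter> {x. u \<bullet> x = b}) I))"
          by blast
        have "K_set {j \<in> J. col j \<in> R'} col (\<lambda>j. C j \<inter> {x. u \<bullet> x = b}) I \<subseteq> K I"
          if "I \<in> F" for I
        proof -
          have "I \<subseteq> R'" using that F(1) by blast
          then show ?thesis unfolding subset_iff mem_K_set_iff by blast
        qed
        then have "0 \<le> (\<Sum>I\<in>F. aff_dim (K I))"
          using F(3) sum_mono[of F] aff_dim_subset by (smt (verit, best))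
        then show ?thesis
          using F R' by (intro exI[of _ F]) (auto simp: color_sets_def)
      qed
      txt \<open>For \<open>k = 2\<close> the induction hypothesis yields a single set, but then \<open>card R - 1\<close> colors
        are used at a time, and varying \<open>c\<close> produces enough of them.\<close>
      show False
      proof (cases "k' = 1 \<and> e \<noteq> 0")
        \<comment> \<open>This includes \<open>k' = 1\<close> with \<open>e = 0\<close>, where a
          single set already makes up \<open>Suc e\<close> sets.\<close>
        case False
        obtain c where c: "c \<in> I0" using color_sets_ne[OF I0(1)] by blast
        obtain F where F: "F \<subseteq> color_sets" "\<forall>I\<in>F. c \<notin> I" "card F = Suc e"
            "0 \<le> (\<Sum>I\<in>F. aff_dim (K I))"
          using slice[OF c] False by (metis One_nat_def)
        \<comment> \<open>Members of \<open>F\<close> avoid \<open>c\<close> while \<open>I0\<close>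
          contains it, so adding \<open>I0\<close> gives \<open>d + 1\<close> distinct sets whose
          dimensions have a nonnegative sum.\<close>
        have "finite F" "I0 \<notin> F" using F c by (auto intro: card_ge_0_finite)
        moreover have "0 \<le> aff_dim (K I0)" using I0(2) by (rule aff_dim_nonneg)
        ultimately show False using neg[of "insert I0 F"] F I0(1) by simp
      next
        case True
        then have "k = 2" using k by (auto simp: k'_def min_def split: if_splits)
        have s: "card I = card R - 1" if "I \<in> color_sets" for I
        proof -
          have "card I = card R - k + 1" using that unfolding color_sets_def by blast
          then show ?thesis using \<open>k = 2\<close> k_le_R by linarith
        qed
        have eq: "I = R - {c}" if "I \<in> color_sets" "c \<in> R" "c \<notin> I" for I c
        proof (rule card_subset_eq)
          show "I \<subseteq> R - {c}" using that unfolding color_sets_def by auto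
          show "card I = card (R - {c})" using s[OF that(1)] that(2) finite_R by simp
        qed (use finite_R in simp)
        \<comment> \<open>The index sets are the complements of single colors. If all of them have
          nonempty \<open>K\<close>, there are \<open>card R > d\<close> such sets, more than
          \<open>few_K_ne\<close> allows.\<close>
        have sub: "R - {c} \<in> {I \<in> color_sets. K I \<noteq> {}}" if c: "c \<in> R" for c
        proof (cases "c \<in> I0")
          case False
          then show ?thesis using eq[OF I0(1) c] I0 by simp
        next
          case c0: True
          obtain F where F: "F \<subseteq> color_sets" "\<forall>I\<in>F. c \<notin> I" "card F = 1"
              "0 \<le> (\<Sum>I\<in>F. aff_dim (K I))"
            using slice[OF c0] True by metis
          obtain I where I: "F = {I}" using F(3) by (auto simp: card_1_singleton_iff)
          then have "I = R - {c}" using eq[OF _ c] F by simp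
          \<comment> \<open>The empty set has dimension -1, so the nonnegative one-term sum makes
            \<open>K I\<close> nonempty.\<close>
          then show ?thesis using F I by auto
        qed
        have "inj_on (\<lambda>c. R - {c}) R" by (auto simp: inj_on_def)
        then have "card R = card ((\<lambda>c. R - {c}) ` R)" by (simp add: card_image)
        also have "\<dots> \<le> card {I \<in> color_sets. K I \<noteq> {}}"
          using sub finite_color_sets by (intro card_mono) auto
        also have "\<dots> \<le> Suc e" by (rule few_K_ne[OF neg])
        finally show False using d_less_R by simp
      qed
    qed
  qed
qed

section \<open>Reduction from convex sets to polytopes\<close>

text \<open>Choose one point \<open>w G\<close> for each of the finitely many intersecting
  subfamilies \<open>G\<close>. The hull of the points chosen for subfamilies containing
  \<open>j\<close> stays in \<open>C j\<close> and keeps a witness of every intersection.\<close>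

lemma inner_polytopes:
  fixes C :: "'i \<Rightarrow> 'a::euclidean_space set"
  assumes "finite J" "\<And>j. j \<in> J \<Longrightarrow> convex (C j)"
  obtains P where "\<And>j. j \<in> J \<Longrightarrow> convex (P j) \<and> compact (P j) \<and> P j \<subseteq> C j"
    "\<And>G. G \<subseteq> J \<Longrightarrow> (\<Inter>j\<in>G. C j) \<noteq> {} \<Longrightarrow> (\<Inter>j\<in>G. P j) \<noteq> {}"
proof -
  define w where "w G = (SOME x. x \<in> (\<Inter>j\<in>G. C j))" for G
  have w: "w G \<in> (\<Inter>j\<in>G. C j)" if "(\<Inter>j\<in>G. C j) \<noteq> {}" for G
    unfolding w_def using that by (rule some_in_eq[THEN iffD2])
  define P where "P j = convex hull (w ` {G. G \<subseteq> J \<and> j \<in> G \<and> (\<Inter>j\<in>G. C j) \<noteq> {}})" for j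
  show ?thesis
  proof (rule that[of P])
    fix j assume j: "j \<in> J"
    have "finite {G. G \<subseteq> J \<and> j \<in> G \<and> (\<Inter>j\<in>G. C j) \<noteq> {}}"
      using assms(1) by simp
    then have "compact (P j)"
      unfolding P_def by (intro finite_imp_compact_convex_hull finite_imageI)
    moreover have "P j \<subseteq> C j"
      unfolding P_def using assms(2)[OF j] w by (intro hull_minimal) blast
    ultimately show "convex (P j) \<and> compact (P j) \<and> P j \<subseteq> C j" by (simp add: P_def)
  next
    fix G assume "G \<subseteq> J" "(\<Inter>j\<in>G. C j) \<noteq> {}"
    then have "w G \<in> P j" if "j \<in> G" for j
      unfolding P_def using that by (intro hull_inc) blast
    then show "(\<Inter>j\<in>G. P j) \<noteq> {}" by blast
  qed
qed

theorem theorem1p7: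
  fixes V :: "'a::euclidean_space set"
    and d r m k s p :: nat
    and J :: "'i set" and col :: "'i \<Rightarrow> nat" and C :: "'i \<Rightarrow> 'a set"
  assumes "subspace V" and "dim V = d"
    and "r \<ge> d + 1" and "1 \<le> m" and "m \<le> r" and "m \<le> k" and "k \<le> min (m + d) r"
    and "finite J"
    and "\<forall>j\<in>J. convex (C j) \<and> C j \<subseteq> V"
    and "col ` J \<subseteq> {1..r}"
    and "\<forall>i\<in>{1..r}. color_class J col i \<noteq> {}"
    and "card J \<ge> m + d \<longrightarrow>
           (\<forall>G. G \<subseteq> J \<and> card G = m + d \<and> k \<le> card {i \<in> {1..r}. G \<inter> color_class J col i \<noteq> {}}
              \<longrightarrow> semi_intersecting d C G)"
    and "r \<le> card J \<and> card J < m + d \<longrightarrow> semi_intersecting d C J"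
    and "s = r - k + 1"
    and "p = (if k = 1 then 1 else d + 1)"
  shows "\<exists>I :: nat \<Rightarrow> nat set.
           inj_on I {1..p} \<and>
           (\<forall>j\<in>{1..p}. I j \<subseteq> {1..r} \<and> card (I j) = s) \<and>
           (\<Sum>j=1..p. aff_dim (K_set J col C (I j))) \<ge> 0"
proof -
  obtain P where P: "\<And>j. j \<in> J \<Longrightarrow> convex (P j) \<and> compact (P j) \<and> P j \<subseteq> C j"
    and P_ne: "\<And>G. G \<subseteq> J \<Longrightarrow> (\<Inter>j\<in>G. C j) \<noteq> {} \<Longrightarrow> (\<Inter>j\<in>G. P j) \<noteq> {}"
    using inner_polytopes[OF \<open>finite J\<close>, of C] assms(9) by metis
  have semi: "semi_intersecting d P G" if GJ: "G \<subseteq> J" and G: "semi_intersecting d C G" for G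
    unfolding semi_intersecting_def
  proof (intro conjI allI impI)
    fix A assume A: "A \<subset> G \<and> card A = d"
    then obtain c where c: "c \<in> G - A" "(\<Inter>j\<in>A \<union> {c}. C j) \<noteq> {}"
      using G unfolding semi_intersecting_def by blast
    have "A \<union> {c} \<subseteq> J" using A c(1) GJ by blast
    then have "(\<Inter>j\<in>A \<union> {c}. P j) \<noteq> {}" using c(2) by (rule P_ne)
    then show "\<exists>c\<in>G - A. (\<Inter>j\<in>A \<union> {c}. P j) \<noteq> {}" using c(1) by (rule bexI)
  qed (use G in \<open>auto simp: semi_intersecting_def\<close>)
  have col: "col ` J = {1..r}"
    using assms(10,11) by (auto simp: color_class_def)
  have "r \<le> card J" using card_image_le[OF \<open>finite J\<close>, of col] col by simp
  have colors: "{i \<in> {1..r}. G \<inter> color_class J col i \<noteq> {}} = col ` G" if "G \<subseteq> J" for G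
  proof -
    have "col ` G \<subseteq> {1..r}" using assms(10) that by blast
    then show ?thesis using that by (auto simp: color_class_def)
  qed
  have "colored_family V d {1..r} J col P m k"
  proof
    show "affine V" using assms(1) by (rule subspace_imp_affine)
    show "aff_dim V = int d" using assms(1,2) by (simp add: aff_dim_subspace)
    show "convex (P j) \<and> compact (P j) \<and> P j \<subseteq> V" if "j \<in> J" for j
      using P[OF that] assms(9) that by blast
    show "semi_intersecting d P G" if "G \<subseteq> J" "card G = m + d" "k \<le> card (col ` G)" for G
      using that assms(12) colors[OF that(1)] card_mono[OF \<open>finite J\<close> that(1)]
      by (intro semi) auto
    show "semi_intersecting d P J" if "card J < m + d"
      using that \<open>r \<le> card J\<close> assms(13) by (intro semi) auto
  qed (use assms col in auto)
  from colored_family_sum_aff_dim[OF this] obtain F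
    where F: "F \<subseteq> {I. I \<subseteq> {1..r} \<and> card I = s}" "card F = p"
      "0 \<le> (\<Sum>I\<in>F. aff_dim (K_set J col P I))"
    using assms(14,15) by auto
  have "F \<subseteq> Pow {1..r}" using F(1) by blast
  then have "finite F" by (rule finite_subset) simp
  then obtain I where I: "bij_betw I {1..p} F"
    using ex_bij_betw_nat_finite_1 F(2) by blast
  \<comment> \<open>Shrinking the sets can only lower the dimensions, so the bound for the polytopes
    carries over.\<close>
  have "K_set J col P A \<subseteq> K_set J col C A" for A
    using P unfolding subset_iff mem_K_set_iff by blast
  then have "(\<Sum>I\<in>F. aff_dim (K_set J col P I)) \<le> (\<Sum>I\<in>F. aff_dim (K_set J col C I))"
    by (intro sum_mono aff_dim_subset)
  also have "\<dots> = (\<Sum>j=1..p. aff_dim (K_set J col C (I j)))"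
    by (rule sum.reindex_bij_betw[OF I, symmetric])
  finally have "0 \<le> (\<Sum>j=1..p. aff_dim (K_set J col C (I j)))" using F(3) by linarith
  then show ?thesis
    using I F(1) by (intro exI[of _ I]) (auto simp: bij_betw_def)
qed

end
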